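(* Let $F_1 = 1$, $F_2 = 1$, and $F_{n} = F_{n-1} + F_{n-2}$ for all integers $n \ge 3$. Then the following hold for the base-10 representations of the Fibonacci numbers: (1) for every $n \ge 1$, the decimal representation of $F_n$ contains at least one digit in $\{0,1,\dots,9\} \setminus \{6\}$; (2) for every $n \ge 1$, the decimal representation of $F_n$ contains at least one digit in $\{0,1,\dots,9\} \setminus \{4\}$; (3) for every $n \ge 1$ with $n \ne 3$, the decimal representation of $F_n$ contains at least one digit in $\{0,1,\dots,9\} \setminus \{2\}$ (the excluded term is $F_3 = 2$).
   Context: The Fibonacci numbers are indexed by $F_1 = 1$, $F_2 = 1$, $F_3 = 2$, and so on. The decimal representation is the usual base-10 representation without leading zeros. *)

theory Defs
  imports "HOL-Number_Theory.Fib"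
begin

(* Most significant digit first; the decimal representation of 0 is [0]. *)
fun decimal_digits :: "nat \<Rightarrow> nat list" where
  "decimal_digits n = (if n < 10 then [n] else decimal_digits (n div 10) @ [n mod 10])"

declare decimal_digits.simps [simp del]

lemma decimal_digits_less_10: "d \<in> set (decimal_digits n) \<Longrightarrow> d < 10"
proof (induction n rule: decimal_digits.induct)
  case (1 n)
  then show ?case
    by (subst (asm) (2) decimal_digits.simps) (auto split: if_splits)
qed

lemma decimal_digits_not_Nil: "decimal_digits n \<noteq> []"
  by (subst decimal_digits.simps) simp

lemma decimal_digits_value: "foldl (\<lambda>v d. 10 * v + d) 0 (decimal_digits n) = n"
proof (induction n rule: decimal_digits.induct)
  case (1 n)
  then show ?case
    by (subst decimal_digits.simps) simp
qed

lemma decimal_digits_no_leading_zero: "n > 0 \<Longrightarrow> hd (decimal_digits n) \<noteq> 0"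
proof (induction n rule: decimal_digits.induct)
  case (1 n)
  then show ?case
    by (subst decimal_digits.simps) (auto simp: decimal_digits_not_Nil hd_append)
qed

end

theory Submission
  imports Defs
begin

text \<open>
  The reason is an obstruction modulo 16.  Since 10000 is divisible by 16, a number with at least
  four digits all equal to \<open>d\<close> is congruent to \<open>1111 * d\<close>, that is to \<open>7 * d\<close>, modulo 16; for
  \<open>d = 6, 4, 2\<close> this gives the residues 10, 12 and 14.  None of these is the residue of a Fibonacci
  number: the only even residues that occur modulo 16 are 0, 2 and 8 (\<open>even_fib_mod_16\<close>).  The
  repdigits \<open>d\<close>, \<open>11 * d\<close> and \<open>111 * d\<close> with fewer digits are excluded in the same way, except 2
  and 66, which are both congruent to 2.  The number 66 lies strictly between the consecutive
  Fibonacci numbers 55 and 89, and 2 occurs only as the third term.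
\<close>

text \<open>The first three alternatives are the repdigits too short to have a four-digit ending.\<close>

lemma repdigit_cases:
  assumes "set (decimal_digits n) \<subseteq> {d}"
  shows "n = d \<or> n = 11 * d \<or> n = 111 * d \<or> n mod 10000 = 1111 * d"
proof -
  have step: "m = d \<or> m mod 10 = d \<and> set (decimal_digits (m div 10)) \<subseteq> {d}"
    if "set (decimal_digits m) \<subseteq> {d}" for m
    using that by (subst (asm) decimal_digits.simps) (auto split: if_splits)
  \<comment> \<open>A single remaining digit \<open>d\<close> also satisfies \<open>d mod 10 = d\<close>, so both outcomes of the fourth
      step yield the fourth digit.\<close>
  have last: "m mod 10 = d" if "set (decimal_digits m) \<subseteq> {d}" for m
    using that by (subst (asm) decimal_digits.simps) (auto split: if_splits)
  define a where "a = n div 10"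
  define b where "b = a div 10"
  define c where "c = b div 10"
  have n: "n = 10 * a + n mod 10" and a: "a = 10 * b + a mod 10" and b: "b = 10 * c + b mod 10"
    by (simp_all add: a_def b_def c_def)
  have four: "n mod 10000 = n mod 10 + 10 * (a mod 10) + 100 * (b mod 10) + 1000 * (c mod 10)"
  proof -
    define r where "r = n mod 10 + 10 * (a mod 10) + 100 * (b mod 10) + 1000 * (c mod 10)"
    have "n = r + 10000 * (c div 10)"
      using n a b mult_div_mod_eq[of 10 c] unfolding r_def by linarith
    moreover have "r < 10000"
      unfolding r_def
      using mod_less_divisor[of 10 n] mod_less_divisor[of 10 a] mod_less_divisor[of 10 b]
        mod_less_divisor[of 10 c] by linarith
    ultimately have "n mod 10000 = r"
      by simp
    then show ?thesis
      by (simp only: r_def)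
  qed
  consider "n = d" | "n mod 10 = d" "a = d" | "n mod 10 = d" "a mod 10 = d" "b = d"
    | "n mod 10 = d" "a mod 10 = d" "b mod 10 = d" "c mod 10 = d"
    using step[OF assms] step[of a] step[of b] last[of c]
    unfolding a_def[symmetric] b_def[symmetric] c_def[symmetric] by argo
  then show ?thesis
  proof cases
    case 2 then show ?thesis using n by linarith
  next
    case 3 then show ?thesis using n a by linarith
  next
    case 4 then show ?thesis using four by linarith
  qed simp
qed

text \<open>
  Going six terms ahead multiplies by 5 and adds 8 times the next term.  Next to an even Fibonacci
  number the next one is odd, so this addend is 8 modulo 16, and the map \<open>x \<mapsto> 5 * x + 8\<close>
  exchanges the residues 0 and 8 and fixes 2.
\<close>

lemma even_fib_mod_16:
  assumes "even (fib n)"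
  shows "fib n mod 16 \<in> {0, 2, 8}"
  using assms
proof (induction n rule: less_induct)
  case (less n)
  have small: "fib 3 = 2" "fib 4 = 3" "fib 5 = 5"
    by (simp_all add: eval_nat_numeral)
  consider "n = 0" | "n = 1" | "n = 2" | "n = 3" | "n = 4" | "n = 5" | "n \<ge> 6"
    by linarith
  then show ?case
  proof cases
    case 7
    define k where "k = n - 6"
    have rec: "fib n = 8 * fib (Suc k) + 5 * fib k"
    proof -
      have "n = Suc (Suc (Suc (Suc (Suc (Suc k)))))"
        using 7 by (simp add: k_def)
      then show ?thesis by simp
    qed
    with less.prems have even: "even (fib k)"
      by simp
    have "odd (fib (Suc k))"
      using even coprime_fib_Suc_nat[of k] coprime_common_divisor[of "fib k" "fib (Suc k)" 2]
      by auto
    then obtain j where j: "fib (Suc k) = 2 * j + 1"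
      by (elim oddE)
    define q r where "q = fib k div 16" and "r = fib k mod 16"
    have k: "fib k = 16 * q + r"
      by (simp add: q_def r_def)
    have "fib n = 16 * (j + 5 * q) + (5 * r + 8)"
      unfolding rec j k by simp
    then have "fib n mod 16 = (5 * r + 8) mod 16"
      by (simp only: mod_mult_self4)
    moreover have "r \<in> {0, 2, 8}"
      using less.IH[of k] even 7 by (simp add: k_def r_def)
    ultimately show ?thesis
      by auto
  qed (use less.prems small in simp_all)
qed

lemma fib_neq_66: "fib n \<noteq> 66"
proof (cases "n \<le> 10")
  case True
  then have "fib n \<le> fib 10" by (rule fib_mono)
  also have "fib 10 = 55" by (simp add: eval_nat_numeral)
  finally show ?thesis by simp
next
  case False
  then have "fib 11 \<le> fib n" by (intro fib_mono) simp
  moreover have "fib 11 = 89" by (simp add: eval_nat_numeral)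
  ultimately show ?thesis by simp
qed

lemma fib_eq_2_imp:
  assumes "fib n = 2"
  shows "n = 3"
proof -
  have "fib 4 = 3" by (simp add: eval_nat_numeral)
  then have "n < 4"
    using assms fib_mono[of 4 n] by (cases "n < 4") auto
  then show ?thesis
    using assms by (auto simp: numeral_eq_Suc less_Suc_eq)
qed

text \<open>
  The digit 8 escapes this argument: \<open>8888\<close> is congruent to 8 modulo 16, a residue that the
  Fibonacci numbers do take.
\<close>

lemma repdigit_fib_even_digit:
  assumes digits: "set (decimal_digits (fib n)) \<subseteq> {d}" and d: "d \<in> {2, 4, 6}"
  shows "d = 2 \<and> n = 3"
proof -
  have rep: "fib n = d \<or> fib n = 11 * d \<or> fib n = 111 * d \<or> fib n mod 10000 = 1111 * d"
    using digits by (rule repdigit_cases)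
  have mod16: "fib n mod 16 = fib n mod 10000 mod 16"
    by (simp add: mod_mod_cancel)
  have "even (fib n mod 10000) = even (fib n)"
    by (simp add: dvd_mod_iff)
  then have "even (fib n)"
    using rep d by auto
  then have "fib n mod 16 \<in> {0, 2, 8}"
    by (rule even_fib_mod_16)
  then have "fib n = 2 \<and> d = 2 \<or> fib n = 66"
    using rep d mod16 by auto
  then show ?thesis
    using fib_neq_66 fib_eq_2_imp by blast
qed

theorem mainTheorem1:
  shows "(\<forall>n\<ge>1. \<exists>d\<in>set (decimal_digits (fib n)). d \<in> {0..9} - {6})
       \<and> (\<forall>n\<ge>1. \<exists>d\<in>set (decimal_digits (fib n)). d \<in> {0..9} - {4})
       \<and> (\<forall>n\<ge>1. n \<noteq> 3 \<longrightarrow> (\<exists>d\<in>set (decimal_digits (fib n)). d \<in> {0..9} - {2}))"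
proof -
  have other: "\<exists>c\<in>set (decimal_digits (fib n)). c \<in> {0..9} - {d}"
    if "d \<in> {2, 4, 6}" "\<not> (d = 2 \<and> n = 3)" for n d
  proof -
    have "\<not> set (decimal_digits (fib n)) \<subseteq> {d}"
    proof
      assume "set (decimal_digits (fib n)) \<subseteq> {d}"
      from repdigit_fib_even_digit[OF this that(1)] that(2) show False by simp
    qed
    then obtain c where c: "c \<in> set (decimal_digits (fib n))" "c \<noteq> d"
      by blast
    have "c < 10"
      using c(1) by (rule decimal_digits_less_10)
    then have "c \<in> {0..9} - {d}"
      using c(2) by simp
    with c(1) show ?thesis ..
  qed
  show ?thesis
    by (intro conjI allI impI; rule other; simp)
qed

end
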